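(* Let $m,n\ge 1$ and $0\le s<m$ be integers and let $\mathbf{M}\in\mathbb{R}^{m\times n}$ be a coded computation strategy that resists $s$ stragglers, i.e. $\mathbf{M}$ is $(m-s)$-recoverable. Then the computation load of $\mathbf{M}$ satisfies $$l(\mathbf{M})\ \geq\ n(s+1).$$
   Context: Setting (coded distributed linear transform): a matrix $\mathbf{A}\in\mathbb{R}^{r\times t}$ (with $n\mid r$) is divided along its rows into $n$ blocks $\mathbf{A}_1,\dots,\mathbf{A}_n\in\mathbb{R}^{\frac{r}{n}\times t}$, and $\mathbf{x}\in\mathbb{R}^t$ is an input vector. There are $m$ workers. A coded computation strategy is a matrix $\mathbf{M}=[m_{ij}]\in\mathbb{R}^{m\times n}$: worker $i\in[m]$ stores $\tilde{\mathbf{A}}_i=\sum_{j=1}^n m_{ij}\mathbf{A}_j$ (so each worker stores a $1/n$ fraction of the size of $\mathbf{A}$) and returns $\tilde{\mathbf{y}}_i=\tilde{\mathbf{A}}_i\mathbf{x}$. The strategy $\mathbf{M}$ is known to the master. $k$-recoverable: $\mathbf{M}$ is $k$-recoverable if for every $I\subseteq[m]$ with $|I|=k$ the vector $\mathbf{A}\mathbf{x}$ can be recovered from $\{\tilde{\mathbf{y}}_i : i\in I\}$, i.e. there is a function (not depending on $\mathbf{A},\mathbf{x}$) that outputs $\mathbf{A}\mathbf{x}$ from $(\tilde{\mathbf{y}}_i)_{i\in I}$ for all $\mathbf{A}$ and $\mathbf{x}$. Resisting $s$ stragglers means that $\mathbf{A}\mathbf{x}$ can be recovered whichever $s$ of the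 $m$ workers fail to return a result, i.e. from the results of any $m-s$ workers. Computation load: $l(\mathbf{M})=\|\mathbf{M}\|_0$, the number of nonzero entries of $\mathbf{M}$. *)

theory Defs
  imports "Jordan_Normal_Form.Matrix"
begin

text \<open>
  Rows, columns, blocks and workers are indexed from 0. A strategy \<open>M\<close> is an \<open>m \<times> n\<close> matrix, so the
  number of workers is \<open>dim_row M\<close> and the number of row blocks is \<open>dim_col M\<close>. The block division is
  meaningful when \<open>n dvd dim_row A\<close>, which the definitions below do not themselves require.
\<close>

definition row_block :: "nat \<Rightarrow> real mat \<Rightarrow> nat \<Rightarrow> real mat" where
  "row_block n A j =
     mat (dim_row A div n) (dim_col A) (\<lambda>(a, b). A $$ (j * (dim_row A div n) + a, b))"

text \<open>
  The sum \<open>\<Sum>j. m\<^sub>i\<^sub>j A\<^sub>j\<close> is written entrywise, since the type of matrices of all dimensions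
  is not an instance of \<open>comm_monoid_add\<close>.
\<close>

definition coded_block :: "real mat \<Rightarrow> real mat \<Rightarrow> nat \<Rightarrow> real mat" where
  "coded_block M A i =
     mat (dim_row A div dim_col M) (dim_col A)
       (\<lambda>(a, b). \<Sum>j<dim_col M. M $$ (i, j) * row_block (dim_col M) A j $$ (a, b))"

definition worker_result :: "real mat \<Rightarrow> real mat \<Rightarrow> real vec \<Rightarrow> nat \<Rightarrow> real vec" where
  "worker_result M A x i = coded_block M A i *\<^sub>v x"

text \<open>
  The decoder \<open>f\<close> may depend on \<open>M\<close> and on the index set \<open>I\<close>, but not on \<open>A\<close> and \<open>x\<close>; because of
  \<open>restrict\<close> it sees the results of the workers in \<open>I\<close> only. The dimensions \<open>r\<close> and \<open>t\<close> of the data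
  matrix are fixed.
\<close>

definition k_recoverable :: "nat \<Rightarrow> nat \<Rightarrow> real mat \<Rightarrow> nat \<Rightarrow> bool" where
  "k_recoverable r t M k \<longleftrightarrow>
     (\<forall>I. I \<subseteq> {..<dim_row M} \<and> card I = k \<longrightarrow>
        (\<exists>f :: (nat \<Rightarrow> real vec) \<Rightarrow> real vec.
           \<forall>A \<in> carrier_mat r t. \<forall>x \<in> carrier_vec t.
             f (restrict (worker_result M A x) I) = A *\<^sub>v x))"

definition resists_stragglers :: "nat \<Rightarrow> nat \<Rightarrow> real mat \<Rightarrow> nat \<Rightarrow> bool" where
  "resists_stragglers r t M s \<longleftrightarrow> k_recoverable r t M (dim_row M - s)"

definition computation_load :: "real mat \<Rightarrow> nat" where
  "computation_load M = card {(i, j). i < dim_row M \<and> j < dim_col M \<and> M $$ (i, j) \<noteq> 0}"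

end

theory Submission
  imports Defs
begin

text \<open>
  If column \<open>j\<close> of \<open>M\<close> vanishes on \<open>k\<close> workers, these workers never see block \<open>j\<close>, so they cannot
  distinguish the zero matrix from a matrix supported on that block. With \<open>k = m - s\<close>, every column
  has at least \<open>s + 1\<close> nonzero entries; sum over the columns.
\<close>

text \<open>The only possible nonzero entry of \<open>A\<close> sits in row 0 of block
  \<open>j\<close>. Every other block is zero, and worker \<open>i\<close> weights block
  \<open>j\<close> by 0.\<close>

lemma coded_block_single_entry:
  assumes A: "A = mat r t (\<lambda>(a, b). if a = j * (r div dim_col M) \<and> b = 0 then 1 else 0)"
    and "M $$ (i, j) = 0"
  shows "coded_block M A i = coded_block M (0\<^sub>m r t) i"
proof (rule eq_matI)
  let ?n = "dim_col M" and ?q = "r div dim_col M"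
  fix a b
  assume "a < dim_row (coded_block M (0\<^sub>m r t) i)" "b < dim_col (coded_block M (0\<^sub>m r t) i)"
  then have a: "a < ?q" and b: "b < t"
    by (simp_all add: coded_block_def)
  \<comment> \<open>Entries of \<open>mat\<close> and of the zero matrix are specified only inside
    their dimensions, so each row index read must be shown to be in range.\<close>
  have lt: "l * ?q + a < r" if "l < ?n" for l
  proof -
    have "l * ?q + a < Suc l * ?q" using a by simp
    also have "\<dots> \<le> ?n * ?q" using that by (intro mult_le_mono1) simp
    also have "\<dots> \<le> r" by simp
    finally show ?thesis .
  qed
  have "M $$ (i, l) * row_block ?n A l $$ (a, b) = M $$ (i, l) * row_block ?n (0\<^sub>m r t) l $$ (a, b)"
    if l: "l < ?n" for l
  proof (cases "l = j")
    case True
    then show ?thesis using assms(2) by simp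
  next
    case False
    \<comment> \<open>Division by the block height recovers the block index of a row, so rows of
      different blocks never coincide.\<close>
    have "(l * ?q + a) div ?q = l" "(j * ?q) div ?q = j" using a by simp_all
    then have "l * ?q + a \<noteq> j * ?q" using False by metis
    then show ?thesis using a b lt[OF l] by (simp add: row_block_def A)
  qed
  then have "(\<Sum>l<?n. M $$ (i, l) * row_block ?n A l $$ (a, b)) =
      (\<Sum>l<?n. M $$ (i, l) * row_block ?n (0\<^sub>m r t) l $$ (a, b))"
    by (intro sum.cong) auto
  moreover have "dim_row A = r" "dim_col A = t" by (simp_all add: A)
  ultimately show "coded_block M A i $$ (a, b) = coded_block M (0\<^sub>m r t) i $$ (a, b)"
    using a b by (simp add: coded_block_def)
qed (simp_all add: coded_block_def A)

lemma k_recoverable_card_column_zeros_less: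
  assumes rec: "k_recoverable r t M k"
    and r: "r \<ge> 1" and t: "t \<ge> 1" and dvd: "dim_col M dvd r" and j: "j < dim_col M"
  shows "card {i. i < dim_row M \<and> M $$ (i, j) = 0} < k"
proof (rule ccontr)
  let ?q = "r div dim_col M"
  assume "\<not> ?thesis"
  then have "k \<le> card {i. i < dim_row M \<and> M $$ (i, j) = 0}" by simp
  then obtain I where I: "I \<subseteq> {i. i < dim_row M \<and> M $$ (i, j) = 0}" "card I = k"
    by (rule obtain_subset_with_card_n)
  then have "I \<subseteq> {..<dim_row M}" by auto
  with rec I(2) have "\<exists>f :: (nat \<Rightarrow> real vec) \<Rightarrow> real vec.
      \<forall>A \<in> carrier_mat r t. \<forall>x \<in> carrier_vec t. f (restrict (worker_result M A x) I) = A *\<^sub>v x"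
    by (simp only: k_recoverable_def)
  then obtain f :: "(nat \<Rightarrow> real vec) \<Rightarrow> real vec" where
    f: "\<forall>A \<in> carrier_mat r t. \<forall>x \<in> carrier_vec t. f (restrict (worker_result M A x) I) = A *\<^sub>v x" ..
  define A :: "real mat" where
    "A = mat r t (\<lambda>(a, b). if a = j * ?q \<and> b = 0 then 1 else 0)"
  have A: "A \<in> carrier_mat r t" by (simp add: A_def)
  \<comment> \<open>This vector selects column 0, where the single 1 of \<open>A\<close>
    lies.\<close>
  let ?x = "unit_vec t 0 :: real vec"
  \<comment> \<open>Outside \<open>I\<close> both restrictions are \<open>undefined\<close>, so
    agreement on \<open>I\<close> makes the decoder inputs equal as functions.\<close>
  have "restrict (worker_result M A ?x) I = restrict (worker_result M (0\<^sub>m r t) ?x) I"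
    using I(1) coded_block_single_entry[OF A_def]
    by (intro restrict_ext) (auto simp: worker_result_def)
  then have eq: "A *\<^sub>v ?x = 0\<^sub>m r t *\<^sub>v ?x"
    using f[rule_format, OF A, of ?x] f[rule_format, of "0\<^sub>m r t" ?x] by simp
  \<comment> \<open>Nonempty blocks make \<open>j * ?q < dim_col M * ?q\<close> strict, and
    divisibility turns the right side into \<open>r\<close>: row \<open>j * ?q\<close> exists, and
    the two products differ there.\<close>
  have "?q > 0" using dvd r by (auto elim: dvdE)
  then have "j * ?q < dim_col M * ?q" using j by simp
  then have lt: "j * ?q < r" using dvd by simp
  have "(A *\<^sub>v ?x) $ (j * ?q) = 1" using lt t by (simp add: A_def row_def)
  moreover have "(0\<^sub>m r t *\<^sub>v ?x) $ (j * ?q) = 0" using lt by simp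
  ultimately show False using eq by simp
qed

lemma computation_load_eq_sum:
  "computation_load M = (\<Sum>j<dim_col M. card {i. i < dim_row M \<and> M $$ (i, j) \<noteq> 0})"
proof -
  let ?S = "SIGMA j:{..<dim_col M}. {i. i < dim_row M \<and> M $$ (i, j) \<noteq> 0}"
  \<comment> \<open>Swapping the pairs puts the column first, so the set fibres over columns and its
    cardinality becomes a sum.\<close>
  have "{(i, j). i < dim_row M \<and> j < dim_col M \<and> M $$ (i, j) \<noteq> 0} = prod.swap ` ?S"
    by force
  then have "computation_load M = card ?S"
    unfolding computation_load_def by (simp add: card_image)
  then show ?thesis by simp
qed

theorem theorem2:
  fixes m n s r t :: nat and M :: "real mat"
  assumes "m \<ge> 1" and "n \<ge> 1" and "s < m"
    and "r \<ge> 1" and "t \<ge> 1" and "n dvd r"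
    and "M \<in> carrier_mat m n"
    and "resists_stragglers r t M s"
  shows "computation_load M \<ge> n * (s + 1)"
proof -
  have dims: "dim_row M = m" "dim_col M = n" using assms(7) by auto
  have "s + 1 \<le> card {i. i < m \<and> M $$ (i, j) \<noteq> 0}" if "j < n" for j
  proof -
    let ?Z = "{i. i < m \<and> M $$ (i, j) = 0}" and ?N = "{i. i < m \<and> M $$ (i, j) \<noteq> 0}"
    \<comment> \<open>Strictness here gives \<open>s + 1\<close> rather than \<open>s\<close>, as
      zeros and nonzeros of a column together number \<open>m\<close>.\<close>
    have "card ?Z < m - s"
      using k_recoverable_card_column_zeros_less[of r t M "m - s" j] assms dims that
      by (simp add: resists_stragglers_def)
    moreover have "card ?Z + card ?N = card (?Z \<union> ?N)"
      by (intro card_Un_disjoint[symmetric]) auto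
    moreover have "?Z \<union> ?N = {..<m}" by auto
    ultimately show ?thesis by simp
  qed
  then have "(\<Sum>j<n. s + 1) \<le> (\<Sum>j<n. card {i. i < m \<and> M $$ (i, j) \<noteq> 0})"
    by (intro sum_mono) auto
  then show ?thesis by (simp add: computation_load_eq_sum dims)
qed

end
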